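(* Fix $\kappa>0$, $i\in\{1,2\}$, $j\ne i$. Let $w^i_\kappa$ be a lower semicontinuous viscosity supersolution on $[0,T)\times\mathcal S$ of the system $$\min\{w-\mathcal M^i\mathcal H^i_\kappa w,\ w-\mathcal H^i_\kappa w\}=0\ \text{ in }\overline{\mathcal I}^i,\qquad \min\{-\partial_tw-\mathcal Lw+\rho^iw-f^i,\ w-\mathcal M^iw\}=0\ \text{ in }\mathcal I^i.$$ For $(t,z)\in[0,T)\times\mathcal S$, $z=(x,y^1,y^2)$, let $$h^i(t,z)=\big(A^i+B^ix^2+C^i\log(y^i+1)+D^i\log(y^j+1)\big)e^{\rho(T-t)},$$ where $$\rho>(2\mu+\sigma^2-\rho^i)_+,\quad A^i>\frac{K^i}{\rho^i+\rho},\quad B^i>\frac{K^i}{\rho^i+\rho-2\mu-\sigma^2},\quad \frac{C_1^\phi}{\lambda\zeta_{max}}e^{-\rho T}>C^i>0,\quad \frac{\kappa}{\lambda\zeta_{max}}e^{-\rho T}>D^i>0.$$ Then there are positive constants $\eta,\eta'$ such that for each $\gamma\in(0,1)$, $w_\kappa^{i,\gamma}:=(1-\gamma)w_\kappa^i+\gamma h^i$ is a viscosity supersolution of $$\min\{w_\kappa^{i,\gamma}-\mathcal M^i\mathcal H_\kappa^iw_\kappa^{i,\gamma},\ w_\kappa^{i,\gamma}-\mathcal H_\kappa^iw_\kappa^{i,\gamma}\}\ge\gamma\eta'\ \text{ in }\overline{\mathcal I}^i,$$ $$\min\{-\partial_tw_\kappa^{i,\gamma}-\mathcal Lw_\kappa^{i,\gamma}+\rho^iw_\kappa^{i,\gamma}-f^i,\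 w_\kappa^{i,\gamma}-\mathcal M^iw_\kappa^{i,\gamma}\}\ge\gamma\eta\ \text{ in }\mathcal I^i.$$
   Context: Constants: $T\in(0,\infty)$, $\mu\in\mathbb R$, $\sigma,\lambda,\Delta,K^1,K^2>0$, $\zeta_{min}<0<\zeta_{max}$, discount factors $\rho^1,\rho^2$. $\mathcal S=(0,\infty)^3$, $\bar{\mathcal S}=[0,\infty)^3$; points are $z=(x,y^1,y^2)$. For player $i\in\{1,2\}$, $j\ne i$ is the other player, and $h(t,z)$ is also written $h(t,x,y^i,y^j)$ (own price first). $a_+=\max(a,0)$. Data: $\Gamma^i(y,\zeta)=ye^{\lambda\zeta}$. $f^i(x,y^i,y^j)=\min\{(y^i-x)\pi^i(y^i,y^j),K^ix\}$, where $\pi^i(y^i,y^j)=1$ if $y^i-y^j\le-\Delta$, $=-\frac1{2\Delta}(y^i-y^j-\Delta)$ if $-\Delta<y^i-y^j<\Delta$, $=0$ if $y^i-y^j\ge\Delta$. The costs $\phi^i:\mathbb R_+\times[\zeta_{min},\zeta_{max}]\to\mathbb R$ are continuous with $C_1^\phi\le\phi^i\le C_2^\phi$ for constants $C_1^\phi,C_2^\phi>0$. Operators: $\mathcal Lh=\mu x\,\partial_xh+\frac{\sigma^2x^2}2\partial_{xx}h$; for locally bounded $h$, $$\mathcal M^ih(t,z)=\sup_{\zeta\in[\zeta_{min},\zeta_{max}]}\{h(t,x,\Gamma^i(y^i,\zeta),y^j)-\phi^i(y^i,\zeta)\},\qquad \mathcal H_\kappa^ih(t,z)=h(t,x,y^i,\Gamma^j(y^j,\zeta^j))-\kappa,$$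 where $\zeta^j=\zeta^j(t,z)\in[\zeta_{min},\zeta_{max}]$ is the (optimal) impulse size of player $j$, which is the same for all $h$: in the underlying two-player impulse game with value functions $v^1_\kappa,v^2_\kappa$, it is a maximizer of $\zeta\mapsto v_\kappa^j(t,x,y^i,\Gamma^j(y^j,\zeta))-\phi^j(y^j,\zeta)$. $\overline{\mathcal I}^i\subset[0,T)\times\bar{\mathcal S}$ is the intervention region of player $j$ (the set where it is optimal for player $j$ to intervene, $v_\kappa^j=\mathcal M^jv_\kappa^j$), and $\mathcal I^i$ is its complement. (Only the fact that $\zeta^j$ takes values in $[\zeta_{min},\zeta_{max}]$ and that $\overline{\mathcal I}^i,\mathcal I^i$ are complementary sets enters the formulation of the system. For reference: $v^i_\kappa(t,z)=\sup_{\alpha^i}J^i_\kappa(t,z,\alpha^i,\alpha^j)$, $\alpha^j$ the best response to $\alpha^i$, with $$J^i_\kappa=\mathbb E\Big[\int_t^Te^{-\rho^i(s-t)}f^i(Z_s)ds-\sum_{t\le\tau_k^i<T}e^{-\rho^i(\tau_k^i-t)}\phi^i(Y^i_{\tau_k^{i-}},\zeta_k^i)-\kappa\sum_{t\le\tau_k^j<T}e^{-\rho^i(\tau_k^j-t)}+e^{-\rho^i(T-t)}g^i(Z_T)\Big],$$ $g^i=f^i$, $Z=(X,Y^1,Y^2)$ started at $z$ at time $t$, $dX=X(\mu\,ds+\sigma\,dW)$, $Y^i$ piecewise constant with $Y^i_{\tau_k^i}=\Gamma^i(Y^i_{\tau_k^{i-}},\zeta^i_k)$; the supremum is over impulse strategies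 $\alpha^i=(\tau^i_k,\zeta^i_k)_k$ of stopping times in $[t,T)$ and $\mathcal F_{\tau^i_k}$-measurable $\zeta^i_k\in[\zeta_{min},\zeta_{max}]$, independent of $\mathcal F_t$, with uniformly integrable number of interventions.) Viscosity supersolution (in $[0,T)\times\mathcal S$, with right-hand sides $a$ on $\overline{\mathcal I}^i$ and $b$ on $\mathcal I^i$; $a=b=0$ for the homogeneous system): a lower semicontinuous $u$ such that for all $(\bar t,\bar z)\in[0,T)\times\mathcal S$ and $\varphi\in C^{1,2}([0,T)\times\bar{\mathcal S})$ with $(u-\varphi)(\bar t,\bar z)=0$ a minimum of $u-\varphi$ on $[0,T)\times\mathcal S$, one has at $(\bar t,\bar z)$: $\min\{u-\mathcal M^i\mathcal H^i_\kappa u,\,u-\mathcal H^i_\kappa u\}\ge a$ if $(\bar t,\bar z)\in\overline{\mathcal I}^i$, and $\min\{-\partial_t\varphi-\mathcal L\varphi+\rho^i\varphi-f^i,\ u-\mathcal M^iu\}\ge b$ if $(\bar t,\bar z)\in\mathcal I^i$. *)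

theory Defs
  imports "HOL-Analysis.Analysis"
begin

text \<open>
  The two players are the two elements of the type \<open>2\<close>. A price state is \<open>(x, y)\<close> with
  \<open>y $ i\<close> the price of player \<open>i\<close>, so that "own price first" notation is not needed.
\<close>

type_synonym state = "real \<times> (real ^ 2)"
type_synonym point = "real \<times> state"

definition rival :: "2 \<Rightarrow> 2" where
  "rival i = (if i = 1 then 2 else 1)"

definition set_price :: "real ^ 2 \<Rightarrow> 2 \<Rightarrow> real \<Rightarrow> real ^ 2" where
  "set_price y i v = (\<chi> k. if k = i then v else y $ k)"

text \<open>The constants and cost functions \<open>(T, \<mu>, \<sigma>, \<lambda>, \<Delta>, K, \<zeta>_min, \<zeta>_max, \<rho>, \<phi>)\<close>.\<close>

record game =
  horizon :: real
  drift :: real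
  vol :: real
  lam :: real
  Delta :: real
  cap :: "2 \<Rightarrow> real"
  zmin :: real
  zmax :: real
  disc :: "2 \<Rightarrow> real"
  cost :: "2 \<Rightarrow> real \<Rightarrow> real \<Rightarrow> real"

definition impulses :: "game \<Rightarrow> real set" where
  "impulses G = {zmin G..zmax G}"

text \<open>
  \<open>C1\<close> and \<open>C2\<close> are the bounds of the intervention costs of both players. Discount rates are
  nonnegative.
\<close>

definition valid_game :: "game \<Rightarrow> real \<Rightarrow> real \<Rightarrow> bool" where
  "valid_game G C1 C2 \<longleftrightarrow>
     0 < horizon G \<and> 0 < vol G \<and> 0 < lam G \<and> 0 < Delta G \<and> (\<forall>i. 0 < cap G i) \<and>
     zmin G < 0 \<and> 0 < zmax G \<and> (\<forall>i. 0 \<le> disc G i) \<and> 0 < C1 \<and> 0 < C2 \<and>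
     (\<forall>i. continuous_on ({0..} \<times> impulses G) (\<lambda>(y, \<zeta>). cost G i y \<zeta>) \<and>
          (\<forall>y\<ge>0. \<forall>\<zeta>\<in>impulses G. C1 \<le> cost G i y \<zeta> \<and> cost G i y \<zeta> \<le> C2))"

definition open_states :: "state set" where
  "open_states = {(x, y). 0 < x \<and> (\<forall>k. 0 < y $ k)}"

definition closed_states :: "state set" where
  "closed_states = {(x, y). 0 \<le> x \<and> (\<forall>k. 0 \<le> y $ k)}"

definition open_dom :: "game \<Rightarrow> point set" where
  "open_dom G = {0..<horizon G} \<times> open_states"

definition closed_dom :: "game \<Rightarrow> point set" where
  "closed_dom G = {0..<horizon G} \<times> closed_states"

definition \<Gamma> :: "game \<Rightarrow> real \<Rightarrow> real \<Rightarrow> real" where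
  "\<Gamma> G y \<zeta> = y * exp (lam G * \<zeta>)"

definition share :: "game \<Rightarrow> real \<Rightarrow> real \<Rightarrow> real" where
  "share G yi yj =
     (if yi - yj \<le> - Delta G then 1
      else if yi - yj < Delta G then - 1 / (2 * Delta G) * (yi - yj - Delta G)
      else 0)"

definition payoff :: "game \<Rightarrow> 2 \<Rightarrow> state \<Rightarrow> real" where
  "payoff G i = (\<lambda>(x, y). min ((y $ i - x) * share G (y $ i) (y $ rival i)) (cap G i * x))"

text \<open>
  The supremum is taken in the extended reals, where it exists for every \<open>u\<close>; it is finite
  when \<open>u\<close> is locally bounded.
\<close>

definition \<M> :: "game \<Rightarrow> 2 \<Rightarrow> (point \<Rightarrow> real) \<Rightarrow> point \<Rightarrow> ereal" where
  "\<M> G i u = (\<lambda>(t, x, y).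
     SUP \<zeta>\<in>impulses G. ereal (u (t, x, set_price y i (\<Gamma> G (y $ i) \<zeta>)) - cost G i (y $ i) \<zeta>))"

text \<open>\<open>Z j p\<close> is the impulse size \<open>\<zeta>\<^sup>j(t, z)\<close> chosen by player \<open>j\<close> at \<open>p = (t, z)\<close>.\<close>

definition \<H> :: "game \<Rightarrow> (2 \<Rightarrow> point \<Rightarrow> real) \<Rightarrow> real \<Rightarrow> 2 \<Rightarrow> (point \<Rightarrow> real) \<Rightarrow> point \<Rightarrow> real" where
  "\<H> G Z \<kappa> i u = (\<lambda>(t, x, y).
     u (t, x, set_price y (rival i) (\<Gamma> G (y $ rival i) (Z (rival i) (t, x, y)))) - \<kappa>)"

text \<open>
  Partial derivatives relative to a set \<open>D\<close> in direction \<open>b\<close>: at boundary points of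
  \<open>[0,T) \<times> closed_states\<close> (in particular at \<open>t = 0\<close>) they are one-sided.
\<close>

definition partial_differentiable :: "point set \<Rightarrow> point \<Rightarrow> (point \<Rightarrow> real) \<Rightarrow> bool" where
  "partial_differentiable D b \<phi> \<longleftrightarrow>
     (\<forall>p\<in>D. (\<lambda>s. \<phi> (p + s *\<^sub>R b)) differentiable (at 0 within {s. p + s *\<^sub>R b \<in> D}))"

definition partial :: "point set \<Rightarrow> point \<Rightarrow> (point \<Rightarrow> real) \<Rightarrow> point \<Rightarrow> real" where
  "partial D b \<phi> p =
     vector_derivative (\<lambda>s. \<phi> (p + s *\<^sub>R b)) (at 0 within {s. p + s *\<^sub>R b \<in> D})"

definition C1_along :: "point set \<Rightarrow> point \<Rightarrow> (point \<Rightarrow> real) \<Rightarrow> bool" where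
  "C1_along D b \<phi> \<longleftrightarrow> partial_differentiable D b \<phi> \<and> continuous_on D (partial D b \<phi>)"

definition time_dir :: point where
  "time_dir = (1, 0)"

definition x_dir :: point where
  "x_dir = (0, 1, 0)"

definition space_dirs :: "point set" where
  "space_dirs = Pair 0 ` Basis"

definition C12 :: "point set \<Rightarrow> (point \<Rightarrow> real) \<Rightarrow> bool" where
  "C12 D \<phi> \<longleftrightarrow> continuous_on D \<phi> \<and> C1_along D time_dir \<phi> \<and>
     (\<forall>b\<in>space_dirs. C1_along D b \<phi> \<and> (\<forall>c\<in>space_dirs. C1_along D c (partial D b \<phi>)))"

definition \<L> :: "game \<Rightarrow> (point \<Rightarrow> real) \<Rightarrow> point \<Rightarrow> real" where
  "\<L> G \<phi> = (\<lambda>(t, x, y).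
     drift G * x * partial (closed_dom G) x_dir \<phi> (t, x, y)
     + (vol G)\<^sup>2 * x\<^sup>2 / 2 * partial (closed_dom G) x_dir (partial (closed_dom G) x_dir \<phi>) (t, x, y))"

definition lower_semicontinuous_on :: "'a::topological_space set \<Rightarrow> ('a \<Rightarrow> real) \<Rightarrow> bool" where
  "lower_semicontinuous_on A u \<longleftrightarrow> (\<forall>p\<in>A. \<forall>c<u p. \<forall>\<^sub>F q in at p within A. c < u q)"

text \<open>
  \<open>Ibar\<close> is the intervention region of the rival of player \<open>i\<close>; \<open>a\<close> and \<open>b\<close> are the right-hand
  sides in \<open>Ibar\<close> and in its complement.
\<close>

definition viscosity_supersolution ::
  "game \<Rightarrow> (2 \<Rightarrow> point \<Rightarrow> real) \<Rightarrow> real \<Rightarrow> 2 \<Rightarrow> point set \<Rightarrow> real \<Rightarrow> real \<Rightarrow> (point \<Rightarrow> real) \<Rightarrow> bool"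
where
  "viscosity_supersolution G Z \<kappa> i Ibar a b u \<longleftrightarrow>
     lower_semicontinuous_on (open_dom G) u \<and>
     (\<forall>p\<in>open_dom G. \<forall>\<phi>.
        C12 (closed_dom G) \<phi> \<and> u p - \<phi> p = 0 \<and> (\<forall>q\<in>open_dom G. u p - \<phi> p \<le> u q - \<phi> q) \<longrightarrow>
        (p \<in> Ibar \<longrightarrow>
           min (ereal (u p) - \<M> G i (\<H> G Z \<kappa> i u) p) (ereal (u p - \<H> G Z \<kappa> i u p)) \<ge> ereal a) \<and>
        (p \<in> closed_dom G - Ibar \<longrightarrow>
           min (ereal (- partial (closed_dom G) time_dir \<phi> p - \<L> G \<phi> p + disc G i * \<phi> p
                       - payoff G i (snd p)))
               (ereal (u p) - \<M> G i u p) \<ge> ereal b))"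

definition strict_barrier ::
  "game \<Rightarrow> 2 \<Rightarrow> real \<Rightarrow> real \<Rightarrow> real \<Rightarrow> real \<Rightarrow> real \<Rightarrow> point \<Rightarrow> real" where
  "strict_barrier G i \<rho> A B C D = (\<lambda>(t, x, y).
     (A + B * x\<^sup>2 + C * ln (y $ i + 1) + D * ln (y $ rival i + 1)) * exp (\<rho> * (horizon G - t)))"

end

theory Submission
  imports Defs
begin

text \<open>
  The function \<open>h = strict_barrier\<close> is a smooth strict supersolution, and the operators of the
  system are such that a convex combination of a supersolution with a smooth strict
  supersolution is strict. If \<open>\<phi>\<close> touches \<open>(1 - \<gamma>) w + \<gamma> h\<close> from below at \<open>p\<close>, then
  \<open>\<psi> = (\<phi> - \<gamma> h) / (1 - \<gamma>)\<close> touches \<open>w\<close> from below at \<open>p\<close>; the parabolic operator is linear in the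
  test function, so the inequality of \<open>w\<close> for \<open>\<psi>\<close> and the strict inequality of \<open>h\<close> add up to the
  inequality for \<open>\<phi>\<close>. The lemmas \<open>C12_lincomb\<close>, \<open>generator_lincomb\<close> and \<open>C12_strict_barrier\<close> justify
  this, the last one because all derivatives of \<open>h\<close> are explicit. For the nonlocal operators no
  test function is involved: \<open>\<H>\<close> is affine and \<open>\<M>\<close> is convex
  (\<open>intervention_convex_combination\<close>).

  The strictness of \<open>h\<close> has two sources. In the parabolic inequality, the terms in \<open>A\<close> and \<open>B\<close>
  dominate \<open>K + K x\<^sup>2\<close>, hence also the running payoff, which is at most \<open>K x\<close>
  (\<open>strict_barrier_generator\<close>). In the nonlocal inequalities, an impulse multiplies a price by at
  most \<open>exp (\<lambda> \<zeta>_max)\<close>, so it raises \<open>ln (y + 1)\<close> by at most \<open>\<lambda> \<zeta>_max\<close> (\<open>ln_price_impulse\<close>); as \<open>C\<close> and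
  \<open>D\<close> are small, this gain is less than the cost of the impulse, which is at least \<open>C1\<close> for the
  player's own impulse and \<open>\<kappa>\<close> for the rival's.
\<close>

section \<open>One-sided partial derivatives\<close>

text \<open>
  Along such a direction the point \<open>0\<close> is not isolated in the set on which the one-sided
  derivative is taken, so that this derivative is unique.
\<close>

definition inward :: "point set \<Rightarrow> point \<Rightarrow> bool" where
  "inward D b \<longleftrightarrow> (\<forall>p\<in>D. \<exists>e>0. \<forall>s. 0 \<le> s \<and> s < e \<longrightarrow> p + s *\<^sub>R b \<in> D)"

definition has_partial :: "point set \<Rightarrow> point \<Rightarrow> (point \<Rightarrow> real) \<Rightarrow> (point \<Rightarrow> real) \<Rightarrow> bool" where
  "has_partial D b f f' \<longleftrightarrow>
     (\<forall>p\<in>D. ((\<lambda>s. f (p + s *\<^sub>R b)) has_vector_derivative f' p) (at 0 within {s. p + s *\<^sub>R b \<in> D}))"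

lemma inward_at_within_neq_bot:
  assumes "inward D b" "p \<in> D"
  shows "at 0 within {s. p + s *\<^sub>R b \<in> D} \<noteq> bot"
proof -
  obtain e where e: "e > 0" "\<And>s. 0 \<le> s \<Longrightarrow> s < e \<Longrightarrow> p + s *\<^sub>R b \<in> D"
    using assms unfolding inward_def by meson
  have "0 islimpt {0<..<e}"
    using islimpt_greaterThanLessThan1[OF e(1)] by simp
  then have "0 islimpt {s. p + s *\<^sub>R b \<in> D}"
    by (rule islimpt_subset) (use e in auto)
  then show ?thesis
    by (simp add: trivial_limit_within)
qed

lemma has_partial_partial:
  assumes "partial_differentiable D b f"
  shows "has_partial D b f (partial D b f)"
  using assms unfolding partial_differentiable_def has_partial_def partial_def
  by (simp add: vector_derivative_works)

lemma partial_eq: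
  assumes "inward D b" "has_partial D b f f'" "p \<in> D"
  shows "partial D b f p = f' p"
  using assms inward_at_within_neq_bot[OF assms(1,3)]
  unfolding partial_def has_partial_def
  by (intro vector_derivative_within) auto

lemma has_partial_C1_along:
  assumes "inward D b" "has_partial D b f f'" "continuous_on D f'"
  shows "C1_along D b f"
proof -
  have "continuous_on D (partial D b f)"
    using assms(3) partial_eq[OF assms(1,2)] by (simp cong: continuous_on_cong)
  moreover have "partial_differentiable D b f"
    using assms(2) unfolding partial_differentiable_def has_partial_def
    by (blast intro: differentiableI_vector)
  ultimately show ?thesis by (simp add: C1_along_def)
qed

text \<open>
  A one-sided derivative within \<open>D\<close> sees only the values on \<open>D\<close>. This gives access to second
  derivatives, since formulas for \<open>partial D b f\<close> are available on \<open>D\<close> only.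
\<close>

lemma has_partial_cong:
  assumes "has_partial D b f f'" "\<And>p. p \<in> D \<Longrightarrow> g p = f p"
  shows "has_partial D b g f'"
  unfolding has_partial_def
proof
  fix p assume p: "p \<in> D"
  show "((\<lambda>s. g (p + s *\<^sub>R b)) has_vector_derivative f' p) (at 0 within {s. p + s *\<^sub>R b \<in> D})"
    by (rule has_vector_derivative_transform[where f="\<lambda>s. f (p + s *\<^sub>R b)"])
       (use p assms in \<open>auto simp: has_partial_def\<close>)
qed

lemma has_partial_lincomb:
  assumes "has_partial D b f f'" "has_partial D b g g'"
  shows "has_partial D b (\<lambda>p. \<alpha> * f p + \<beta> * g p) (\<lambda>p. \<alpha> * f' p + \<beta> * g' p)"
  using assms unfolding has_partial_def
  by (auto intro!: derivative_eq_intros)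

lemma partial_lincomb:
  assumes "inward D b" "C1_along D b f" "C1_along D b g" "p \<in> D"
  shows "partial D b (\<lambda>p. \<alpha> * f p + \<beta> * g p) p = \<alpha> * partial D b f p + \<beta> * partial D b g p"
  using assms
  by (intro partial_eq[where f'="\<lambda>p. \<alpha> * partial D b f p + \<beta> * partial D b g p"]
      has_partial_lincomb has_partial_partial) (auto simp: C1_along_def)

lemma has_partial_lincomb_cong:
  assumes "C1_along D b f" "C1_along D b g" "\<And>p. p \<in> D \<Longrightarrow> k p = \<alpha> * f p + \<beta> * g p"
  shows "has_partial D b k (\<lambda>p. \<alpha> * partial D b f p + \<beta> * partial D b g p)"
  by (rule has_partial_cong[OF has_partial_lincomb, OF has_partial_partial has_partial_partial])
     (use assms in \<open>auto simp: C1_along_def\<close>)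

lemma C1_along_lincomb_cong:
  assumes "inward D b" "C1_along D b f" "C1_along D b g"
    and "\<And>p. p \<in> D \<Longrightarrow> k p = \<alpha> * f p + \<beta> * g p"
  shows "C1_along D b k"
  by (rule has_partial_C1_along[OF assms(1) has_partial_lincomb_cong[OF assms(2-4)]])
     (use assms in \<open>auto simp: C1_along_def intro!: continuous_on_add continuous_on_mult_left\<close>)

section \<open>Test functions and the parabolic operator\<close>

lemma inward_time_dir: "inward (closed_dom G) time_dir"
  unfolding inward_def
proof
  fix p assume "p \<in> closed_dom G"
  then show "\<exists>e>0. \<forall>s. 0 \<le> s \<and> s < e \<longrightarrow> p + s *\<^sub>R time_dir \<in> closed_dom G"
    by (intro exI[of _ "horizon G - fst p"])
       (auto simp: closed_dom_def time_dir_def)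
qed

lemma inward_space_dirs:
  assumes "b \<in> space_dirs"
  shows "inward (closed_dom G) b"
  unfolding inward_def
proof
  fix p assume "p \<in> closed_dom G"
  moreover obtain bx "by" where b: "b = (0, bx, by)" "0 \<le> bx" "\<And>k. 0 \<le> by $ k"
    using assms by (auto simp: space_dirs_def Basis_prod_def Basis_vec_def axis_def)
  ultimately show "\<exists>e>0. \<forall>s. 0 \<le> s \<and> s < e \<longrightarrow> p + s *\<^sub>R b \<in> closed_dom G"
    by (intro exI[of _ 1]) (auto simp: closed_dom_def closed_states_def)
qed

lemma x_dir_in_space_dirs: "x_dir \<in> space_dirs"
  by (auto simp: x_dir_def space_dirs_def Basis_prod_def)

lemma C12_lincomb:
  assumes "C12 (closed_dom G) f" "C12 (closed_dom G) g"
  shows "C12 (closed_dom G) (\<lambda>p. \<alpha> * f p + \<beta> * g p)"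
  unfolding C12_def
proof (intro conjI ballI)
  let ?D = "closed_dom G"
  have C1: "continuous_on ?D k" "C1_along ?D time_dir k"
    "\<And>b. b \<in> space_dirs \<Longrightarrow> C1_along ?D b k"
    "\<And>b c. b \<in> space_dirs \<Longrightarrow> c \<in> space_dirs \<Longrightarrow> C1_along ?D c (partial ?D b k)"
    if "C12 ?D k" for k
    using that unfolding C12_def by blast+
  note f = C1[OF assms(1)] and g = C1[OF assms(2)]
  show "continuous_on ?D (\<lambda>p. \<alpha> * f p + \<beta> * g p)"
    by (intro continuous_intros f g)
  show "C1_along ?D time_dir (\<lambda>p. \<alpha> * f p + \<beta> * g p)"
    by (rule C1_along_lincomb_cong[OF inward_time_dir f(2) g(2) refl])
  fix b assume b: "b \<in> space_dirs"
  show "C1_along ?D b (\<lambda>p. \<alpha> * f p + \<beta> * g p)"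
    by (rule C1_along_lincomb_cong[OF inward_space_dirs[OF b] f(3)[OF b] g(3)[OF b] refl])
  fix c assume c: "c \<in> space_dirs"
  show "C1_along ?D c (partial ?D b (\<lambda>p. \<alpha> * f p + \<beta> * g p))"
    by (rule C1_along_lincomb_cong[OF inward_space_dirs[OF c] f(4)[OF b c] g(4)[OF b c]
          partial_lincomb[OF inward_space_dirs[OF b] f(3)[OF b] g(3)[OF b]]])
qed

definition generator :: "game \<Rightarrow> 2 \<Rightarrow> (point \<Rightarrow> real) \<Rightarrow> point \<Rightarrow> real" where
  "generator G i \<phi> p = - partial (closed_dom G) time_dir \<phi> p - \<L> G \<phi> p + disc G i * \<phi> p"

lemma generator_lincomb:
  assumes f: "C12 (closed_dom G) f" and g: "C12 (closed_dom G) g" and p: "p \<in> closed_dom G"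
  shows "generator G i (\<lambda>p. \<alpha> * f p + \<beta> * g p) p = \<alpha> * generator G i f p + \<beta> * generator G i g p"
proof -
  obtain t x y where [simp]: "p = (t, x, y)" by (cases p)
  let ?D = "closed_dom G" and ?k = "\<lambda>p. \<alpha> * f p + \<beta> * g p"
  have "C1_along ?D x_dir f" "C1_along ?D x_dir g"
    "C1_along ?D x_dir (partial ?D x_dir f)" "C1_along ?D x_dir (partial ?D x_dir g)"
    "C1_along ?D time_dir f" "C1_along ?D time_dir g"
    using f g x_dir_in_space_dirs by (auto simp: C12_def)
  note C1 = this
  note inw = inward_space_dirs[OF x_dir_in_space_dirs, of G]
  have t: "partial ?D time_dir ?k p = \<alpha> * partial ?D time_dir f p + \<beta> * partial ?D time_dir g p"
    by (rule partial_lincomb[OF inward_time_dir C1(5,6) p])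
  have x: "partial ?D x_dir ?k q = \<alpha> * partial ?D x_dir f q + \<beta> * partial ?D x_dir g q"
    if "q \<in> ?D" for q
    by (rule partial_lincomb[OF inw C1(1,2) that])
  have xx: "partial ?D x_dir (partial ?D x_dir ?k) p =
      \<alpha> * partial ?D x_dir (partial ?D x_dir f) p + \<beta> * partial ?D x_dir (partial ?D x_dir g) p"
    by (rule partial_eq[OF inw has_partial_lincomb_cong[OF C1(3,4) x] p])
  show ?thesis
    using t x[OF p] xx by (simp add: generator_def \<L>_def algebra_simps add_divide_distrib)
qed

section \<open>The barrier is a smooth strict supersolution\<close>

lemma rival_neq: "rival i \<noteq> i"
  using exhaust_2[of i] by (auto simp: rival_def)

lemma set_price_nth:
  "set_price y i v $ k = (if k = i then v else y $ k)"
  by (simp add: set_price_def)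

text \<open>
  The first and second derivatives of the barrier, in arbitrary spatial directions \<open>(bx, by)\<close>
  and \<open>(cx, cy)\<close>: one formula then covers all pairs of coordinate directions.
\<close>

definition barrier_deriv ::
  "game \<Rightarrow> 2 \<Rightarrow> real \<Rightarrow> real \<Rightarrow> real \<Rightarrow> real \<Rightarrow> state \<Rightarrow> point \<Rightarrow> real" where
  "barrier_deriv G i \<rho> B C D = (\<lambda>(bx, by) (t, x, y).
     (2 * B * x * bx + C * by $ i / (y $ i + 1) + D * by $ rival i / (y $ rival i + 1))
       * exp (\<rho> * (horizon G - t)))"

definition barrier_deriv2 ::
  "game \<Rightarrow> 2 \<Rightarrow> real \<Rightarrow> real \<Rightarrow> real \<Rightarrow> real \<Rightarrow> state \<Rightarrow> state \<Rightarrow> point \<Rightarrow> real" where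
  "barrier_deriv2 G i \<rho> B C D = (\<lambda>(bx, by) (cx, cy) (t, x, y).
     (2 * B * bx * cx - C * by $ i * cy $ i / (y $ i + 1)\<^sup>2
       - D * by $ rival i * cy $ rival i / (y $ rival i + 1)\<^sup>2)
       * exp (\<rho> * (horizon G - t)))"

lemma closed_dom_price_nonneg: "(t, x, y) \<in> closed_dom G \<Longrightarrow> 0 \<le> y $ k"
  by (auto simp: closed_dom_def closed_states_def)

lemma closed_dom_price_pos: "p \<in> closed_dom G \<Longrightarrow> 0 < snd (snd p) $ k + 1"
  using closed_dom_price_nonneg[of "fst p" "fst (snd p)" "snd (snd p)"] by (simp add: add_nonneg_pos)

lemma has_partial_time_barrier:
  "has_partial (closed_dom G) time_dir (strict_barrier G i \<rho> A B C D)
     (\<lambda>p. - \<rho> * strict_barrier G i \<rho> A B C D p)"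
  unfolding has_partial_def
proof
  fix p assume "p \<in> closed_dom G"
  obtain t x y where "p = (t, x, y)" by (cases p)
  then show "((\<lambda>s. strict_barrier G i \<rho> A B C D (p + s *\<^sub>R time_dir)) has_vector_derivative
      - \<rho> * strict_barrier G i \<rho> A B C D p) (at 0 within {s. p + s *\<^sub>R time_dir \<in> closed_dom G})"
    unfolding has_real_derivative_iff_has_vector_derivative[symmetric]
    by (auto simp: strict_barrier_def time_dir_def intro!: derivative_eq_intros)
qed

lemma has_partial_space_barrier:
  "has_partial (closed_dom G) (0, b) (strict_barrier G i \<rho> A B C D) (barrier_deriv G i \<rho> B C D b)"
  unfolding has_partial_def
proof
  fix p assume p: "p \<in> closed_dom G"
  obtain t x y where [simp]: "p = (t, x, y)" by (cases p)
  obtain bx "by" where [simp]: "b = (bx, by)" by (cases b)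
  have pos: "0 < y $ k + 1" for k
    using closed_dom_price_pos[OF p] by simp
  show "((\<lambda>s. strict_barrier G i \<rho> A B C D (p + s *\<^sub>R (0, b))) has_vector_derivative
      barrier_deriv G i \<rho> B C D b p) (at 0 within {s. p + s *\<^sub>R (0, b) \<in> closed_dom G})"
    unfolding has_real_derivative_iff_has_vector_derivative[symmetric]
    using pos[of i] pos[of "rival i"]
    by (auto simp: strict_barrier_def barrier_deriv_def mult.commute intro!: derivative_eq_intros)
qed

lemma has_partial_barrier_deriv:
  "has_partial (closed_dom G) (0, c) (barrier_deriv G i \<rho> B C D b) (barrier_deriv2 G i \<rho> B C D b c)"
  unfolding has_partial_def
proof
  fix p assume p: "p \<in> closed_dom G"
  obtain t x y where [simp]: "p = (t, x, y)" by (cases p)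
  obtain bx "by" where [simp]: "b = (bx, by)" by (cases b)
  obtain cx cy where [simp]: "c = (cx, cy)" by (cases c)
  have pos: "0 < y $ k + 1" for k
    using closed_dom_price_pos[OF p] by simp
  show "((\<lambda>s. barrier_deriv G i \<rho> B C D b (p + s *\<^sub>R (0, c))) has_vector_derivative
      barrier_deriv2 G i \<rho> B C D b c p) (at 0 within {s. p + s *\<^sub>R (0, c) \<in> closed_dom G})"
    unfolding has_real_derivative_iff_has_vector_derivative[symmetric]
    using pos[of i] pos[of "rival i"]
    by (auto simp: barrier_deriv_def barrier_deriv2_def power2_eq_square
        intro!: derivative_eq_intros)
qed

lemma continuous_on_barrier:
  "continuous_on (closed_dom G) (strict_barrier G i \<rho> A B C D)"
  "continuous_on (closed_dom G) (barrier_deriv G i \<rho> B C D b)"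
  "continuous_on (closed_dom G) (barrier_deriv2 G i \<rho> B C D b c)"
  using closed_dom_price_pos[of _ G i] closed_dom_price_pos[of _ G "rival i"]
  unfolding strict_barrier_def barrier_deriv_def barrier_deriv2_def case_prod_beta
  by (intro continuous_intros; force)+

lemma C12_strict_barrier: "C12 (closed_dom G) (strict_barrier G i \<rho> A B C D)"
  unfolding C12_def
proof (intro conjI ballI)
  let ?D = "closed_dom G" and ?h = "strict_barrier G i \<rho> A B C D"
  show "continuous_on ?D ?h"
    by (rule continuous_on_barrier)
  show "C1_along ?D time_dir ?h"
    by (rule has_partial_C1_along[OF inward_time_dir has_partial_time_barrier])
       (intro continuous_intros continuous_on_barrier)
  fix b assume b: "b \<in> space_dirs"
  then obtain b' where [simp]: "b = (0, b')"
    by (auto simp: space_dirs_def)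
  note inw = inward_space_dirs[OF b]
  show "C1_along ?D b ?h"
    by (rule has_partial_C1_along[OF inw _ continuous_on_barrier(2)])
       (simp, rule has_partial_space_barrier)
  fix c assume c: "c \<in> space_dirs"
  then obtain c' where [simp]: "c = (0, c')"
    by (auto simp: space_dirs_def)
  have "partial ?D b ?h p = barrier_deriv G i \<rho> B C D b' p" if "p \<in> ?D" for p
    using partial_eq[OF inw _ that] has_partial_space_barrier by simp
  then have "has_partial ?D c (partial ?D b ?h) (barrier_deriv2 G i \<rho> B C D b' c')"
    using has_partial_cong[OF has_partial_barrier_deriv] by simp
  then show "C1_along ?D c (partial ?D b ?h)"
    by (rule has_partial_C1_along[OF inward_space_dirs[OF c] _ continuous_on_barrier(3)])
qed

lemma generator_strict_barrier_eq:
  assumes p: "(t, x, y) \<in> closed_dom G"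
  shows "generator G i (strict_barrier G i \<rho> A B C D) (t, x, y) =
    ((disc G i + \<rho>) * (A + C * ln (y $ i + 1) + D * ln (y $ rival i + 1))
      + (disc G i + \<rho> - 2 * drift G - (vol G)\<^sup>2) * B * x\<^sup>2) * exp (\<rho> * (horizon G - t))"
proof -
  let ?D = "closed_dom G" and ?h = "strict_barrier G i \<rho> A B C D"
  note inw = inward_space_dirs[OF x_dir_in_space_dirs, of G]
  have t: "partial ?D time_dir ?h (t, x, y) = - \<rho> * ?h (t, x, y)"
    by (rule partial_eq[OF inward_time_dir has_partial_time_barrier p])
  have x: "partial ?D x_dir ?h q = barrier_deriv G i \<rho> B C D (1, 0) q" if "q \<in> ?D" for q
    using partial_eq[OF inw _ that] has_partial_space_barrier by (simp add: x_dir_def)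
  have xx: "partial ?D x_dir (partial ?D x_dir ?h) (t, x, y) =
      barrier_deriv2 G i \<rho> B C D (1, 0) (1, 0) (t, x, y)"
    using has_partial_cong[OF has_partial_barrier_deriv x] partial_eq[OF inw _ p]
    by (simp add: x_dir_def)
  show ?thesis
    unfolding generator_def \<L>_def prod.case t x[OF p] xx
    by (simp add: strict_barrier_def barrier_deriv_def barrier_deriv2_def field_simps power2_eq_square)
qed

lemma payoff_le_cap:
  "payoff G i (x, y) \<le> cap G i * x"
  by (simp add: payoff_def)

text \<open>
  The running payoff grows linearly in \<open>x\<close>, and \<open>K x \<le> K + K x\<^sup>2\<close>: the constant is absorbed by
  \<open>A\<close> and the quadratic term by \<open>B\<close>.
\<close>

lemma strict_barrier_generator:
  assumes K: "0 \<le> cap G i" and \<rho>: "0 \<le> \<rho>" and r: "0 \<le> disc G i + \<rho>"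
    and A: "cap G i \<le> (disc G i + \<rho>) * A"
    and B: "cap G i \<le> (disc G i + \<rho> - 2 * drift G - (vol G)\<^sup>2) * B"
    and C: "0 \<le> C" and D: "0 \<le> D" and p: "p \<in> closed_dom G"
  shows "(disc G i + \<rho>) * A - cap G i
    \<le> generator G i (strict_barrier G i \<rho> A B C D) p - payoff G i (snd p)"
proof -
  obtain t x y where p': "p = (t, x, y)" by (cases p)
  let ?r = "disc G i + \<rho>" and ?s = "disc G i + \<rho> - 2 * drift G - (vol G)\<^sup>2"
  let ?E = "exp (\<rho> * (horizon G - t))"
  let ?Q = "?r * (A + C * ln (y $ i + 1) + D * ln (y $ rival i + 1)) + ?s * B * x\<^sup>2"
  have y: "0 \<le> y $ k" for k
    using closed_dom_price_nonneg p p' by blast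
  have "0 \<le> horizon G - t"
    using p p' by (auto simp: closed_dom_def)
  then have E: "1 \<le> ?E"
    using \<rho> by simp
  have "0 \<le> ?r * (C * ln (y $ i + 1) + D * ln (y $ rival i + 1))"
    using r C D y by simp
  moreover have "cap G i * x\<^sup>2 \<le> ?s * B * x\<^sup>2"
    using B by (rule mult_right_mono) simp
  ultimately have Q: "?r * A + cap G i * x\<^sup>2 \<le> ?Q"
    by (simp add: distrib_left)
  moreover have "0 \<le> cap G i * x\<^sup>2"
    using K by simp
  ultimately have "0 \<le> ?Q"
    using A K by linarith
  then have QE: "?Q \<le> ?Q * ?E"
    using E mult_left_mono[of 1 ?E ?Q] by simp
  have "0 \<le> (x - 1/2)\<^sup>2"
    by simp
  then have "x \<le> 1 + x\<^sup>2"
    by (simp add: power2_eq_square algebra_simps)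
  then have "cap G i * x \<le> cap G i * (1 + x\<^sup>2)"
    using K by (rule mult_left_mono)
  then have "cap G i * x \<le> cap G i + cap G i * x\<^sup>2"
    by (simp add: distrib_left)
  moreover have "generator G i (strict_barrier G i \<rho> A B C D) p = ?Q * ?E"
    using generator_strict_barrier_eq p p' by simp
  ultimately show ?thesis
    using Q QE payoff_le_cap[of G i x y] p' by simp
qed

text \<open>
  Let \<open>e \<ge> 1\<close> be the largest factor by which an impulse multiplies a price. The new price is at
  most \<open>y e\<close>, and \<open>y e + 1 \<le> (y + 1) e\<close>.
\<close>

lemma ln_price_impulse:
  assumes "0 \<le> y" "0 \<le> lam G" "0 \<le> zmax G" "\<zeta> \<le> zmax G"
  shows "ln (\<Gamma> G y \<zeta> + 1) \<le> ln (y + 1) + lam G * zmax G"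
proof -
  let ?e = "exp (lam G * zmax G)"
  have "exp (lam G * \<zeta>) \<le> ?e"
    using assms by (simp add: mult_left_mono)
  then have "\<Gamma> G y \<zeta> \<le> y * ?e"
    using assms by (auto simp: \<Gamma>_def intro: mult_left_mono)
  moreover have "1 \<le> ?e"
    using assms by simp
  ultimately have "\<Gamma> G y \<zeta> + 1 \<le> y * ?e + ?e"
    by (rule add_mono)
  then have "\<Gamma> G y \<zeta> + 1 \<le> (y + 1) * ?e"
    by (simp add: distrib_right)
  moreover have "0 < \<Gamma> G y \<zeta> + 1"
    using assms by (simp add: \<Gamma>_def add_nonneg_pos)
  ultimately have "ln (\<Gamma> G y \<zeta> + 1) \<le> ln ((y + 1) * ?e)"
    by simp
  also have "\<dots> = ln (y + 1) + lam G * zmax G"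
    using assms by (simp add: ln_mult)
  finally show ?thesis .
qed

lemma exp_horizon_bound:
  assumes "t \<ge> 0" "0 \<le> \<rho>" "0 \<le> a"
  shows "a * exp (\<rho> * (horizon G - t)) \<le> a * exp (\<rho> * horizon G)"
  using assms by (intro mult_left_mono) (auto intro: mult_left_mono)

lemma strict_barrier_own_impulse:
  assumes "0 \<le> t" "\<And>k. 0 \<le> y $ k" "0 \<le> \<rho>" "0 \<le> C" "0 \<le> lam G" "0 \<le> zmax G" "\<zeta> \<le> zmax G"
  shows "strict_barrier G i \<rho> A B C D (t, x, set_price y i (\<Gamma> G (y $ i) \<zeta>))
    \<le> strict_barrier G i \<rho> A B C D (t, x, y) + C * (lam G * zmax G) * exp (\<rho> * horizon G)"
proof -
  let ?E = "exp (\<rho> * (horizon G - t))"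
  have "C * ln (\<Gamma> G (y $ i) \<zeta> + 1) \<le> C * (ln (y $ i + 1) + lam G * zmax G)"
    using assms by (intro mult_left_mono ln_price_impulse) auto
  then have "C * ln (\<Gamma> G (y $ i) \<zeta> + 1) * ?E \<le> C * (ln (y $ i + 1) + lam G * zmax G) * ?E"
    by (rule mult_right_mono) simp
  moreover have "C * (lam G * zmax G) * ?E \<le> C * (lam G * zmax G) * exp (\<rho> * horizon G)"
    using assms by (intro exp_horizon_bound) auto
  ultimately show ?thesis
    using rival_neq[of i] by (simp add: strict_barrier_def set_price_nth algebra_simps)
qed

lemma strict_barrier_rival_impulse:
  assumes "0 \<le> t" "\<And>k. 0 \<le> y $ k" "0 \<le> \<rho>" "0 \<le> D" "0 \<le> lam G" "0 \<le> zmax G" "\<zeta> \<le> zmax G"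
  shows "strict_barrier G i \<rho> A B C D (t, x, set_price y (rival i) (\<Gamma> G (y $ rival i) \<zeta>))
    \<le> strict_barrier G i \<rho> A B C D (t, x, y) + D * (lam G * zmax G) * exp (\<rho> * horizon G)"
proof -
  let ?E = "exp (\<rho> * (horizon G - t))"
  have "D * ln (\<Gamma> G (y $ rival i) \<zeta> + 1) \<le> D * (ln (y $ rival i + 1) + lam G * zmax G)"
    using assms by (intro mult_left_mono ln_price_impulse) auto
  then have "D * ln (\<Gamma> G (y $ rival i) \<zeta> + 1) * ?E
      \<le> D * (ln (y $ rival i + 1) + lam G * zmax G) * ?E"
    by (rule mult_right_mono) simp
  moreover have "D * (lam G * zmax G) * ?E \<le> D * (lam G * zmax G) * exp (\<rho> * horizon G)"
    using assms by (intro exp_horizon_bound) auto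
  ultimately show ?thesis
    using rival_neq[of i] by (simp add: strict_barrier_def set_price_nth algebra_simps)
qed

section \<open>Convex combinations under the nonlocal operators\<close>

text \<open>
  This removes the extended reals: it also holds for the infinite suprema, as those equal to
  \<open>\<infinity>\<close> violate both sides and the supremum over the empty set satisfies both.
\<close>

lemma ereal_le_minus_SUP_iff:
  fixes f :: "'a \<Rightarrow> real"
  shows "ereal b \<le> ereal u - (SUP \<zeta>\<in>S. ereal (f \<zeta>)) \<longleftrightarrow> (\<forall>\<zeta>\<in>S. f \<zeta> + b \<le> u)"
proof -
  have "ereal b \<le> ereal u - m \<longleftrightarrow> m \<le> ereal (u - b)" for m :: ereal
    by (cases m) (auto simp: algebra_simps)
  then have "ereal b \<le> ereal u - (SUP \<zeta>\<in>S. ereal (f \<zeta>)) \<longleftrightarrow> (\<forall>\<zeta>\<in>S. ereal (f \<zeta>) \<le> ereal (u - b))"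
    by (simp only: SUP_le_iff)
  also have "\<dots> \<longleftrightarrow> (\<forall>\<zeta>\<in>S. f \<zeta> + b \<le> u)"
    by (simp add: le_diff_eq)
  finally show ?thesis .
qed

lemma \<H>_convex_combination:
  "\<H> G Z \<kappa> i (\<lambda>p. (1 - \<gamma>) * u p + \<gamma> * v p) = (\<lambda>p. (1 - \<gamma>) * \<H> G Z \<kappa> i u p + \<gamma> * \<H> G Z \<kappa> i v p)"
  by (rule ext) (auto simp: \<H>_def algebra_simps split: prod.split)

text \<open>
  The cost of an impulse is an affine term and \<open>(1 - \<gamma>) + \<gamma> = 1\<close>, so for each impulse size the
  inequalities of \<open>u\<close> and \<open>v\<close> are averaged. The values \<open>a\<close> and \<open>b\<close> are separate from \<open>u\<close> and \<open>v\<close> in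
  order to cover both \<open>\<M>\<close> and \<open>\<M> \<circ> \<H>\<close>.
\<close>

lemma intervention_convex_combination:
  assumes "ereal 0 \<le> ereal a - \<M> G i u (t, x, y)"
    and "\<And>\<zeta>. \<zeta> \<in> impulses G \<Longrightarrow>
      v (t, x, set_price y i (\<Gamma> G (y $ i) \<zeta>)) - cost G i (y $ i) \<zeta> + \<delta> \<le> b"
    and "0 \<le> \<gamma>" "\<gamma> \<le> 1"
  shows "ereal (\<gamma> * \<delta>) \<le> ereal ((1 - \<gamma>) * a + \<gamma> * b) - \<M> G i (\<lambda>p. (1 - \<gamma>) * u p + \<gamma> * v p) (t, x, y)"
  unfolding \<M>_def prod.case ereal_le_minus_SUP_iff
proof
  fix \<zeta> assume \<zeta>: "\<zeta> \<in> impulses G"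
  let ?q = "(t, x, set_price y i (\<Gamma> G (y $ i) \<zeta>))" and ?c = "cost G i (y $ i) \<zeta>"
  have "u ?q - ?c \<le> a"
    using assms(1) \<zeta> unfolding \<M>_def prod.case ereal_le_minus_SUP_iff by auto
  then have "(1 - \<gamma>) * (u ?q - ?c) \<le> (1 - \<gamma>) * a"
    using assms by (intro mult_left_mono) auto
  moreover have "\<gamma> * (v ?q - ?c + \<delta>) \<le> \<gamma> * b"
    using assms \<zeta> by (intro mult_left_mono) auto
  ultimately show "(1 - \<gamma>) * u ?q + \<gamma> * v ?q - ?c + \<gamma> * \<delta> \<le> (1 - \<gamma>) * a + \<gamma> * b"
    by (simp add: algebra_simps)
qed

lemma lower_semicontinuous_on_add_continuous:
  assumes u: "lower_semicontinuous_on S u" and v: "continuous_on S v" and "0 < a"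
  shows "lower_semicontinuous_on S (\<lambda>p. a * u p + v p)"
  unfolding lower_semicontinuous_on_def
proof (intro ballI allI impI)
  fix p c assume p: "p \<in> S" and c: "c < a * u p + v p"
  define e where "e = (a * u p + v p - c) / 2"
  have e: "0 < e"
    using c by (simp add: e_def)
  have "u p - e / a < u p"
    using e \<open>0 < a\<close> by simp
  then have "\<forall>\<^sub>F q in at p within S. u p - e / a < u q"
    using u p by (auto simp: lower_semicontinuous_on_def)
  moreover have "\<forall>\<^sub>F q in at p within S. v p - e < v q"
    using v p e by (intro order_tendstoD(1)[of v "v p"]) (auto simp: continuous_on_def)
  ultimately show "\<forall>\<^sub>F q in at p within S. c < a * u q + v q"
  proof eventually_elim
    case (elim q)
    have "a * (u p - e / a) < a * u q"
      using elim \<open>0 < a\<close> by (intro mult_strict_left_mono) auto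
    then show ?case
      using elim \<open>0 < a\<close> by (simp add: e_def field_simps)
  qed
qed

section \<open>Strict supersolutions from the barrier\<close>

lemma open_dom_subset_closed_dom: "open_dom G \<subseteq> closed_dom G"
  by (auto simp: open_dom_def closed_dom_def open_states_def closed_states_def less_imp_le)

lemma impulse_gain_less:
  assumes "c / l * exp (- \<rho> * T) > a" "0 < l"
  shows "0 < c - a * l * exp (\<rho> * (T::real))"
proof -
  have "a * l < c * exp (- \<rho> * T)"
    using assms by (simp add: field_simps)
  then have "a * l * exp (\<rho> * T) < c * exp (- \<rho> * T) * exp (\<rho> * T)"
    by (intro mult_strict_right_mono) auto
  also have "\<dots> = c"
    by (simp add: mult.assoc exp_add[symmetric])
  finally show ?thesis by simp
qed

theorem mainTheorem10:
  fixes G :: game and C1 C2 \<kappa> \<rho> A B C D :: real and i :: 2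
    and Z :: "2 \<Rightarrow> point \<Rightarrow> real" and Ibar :: "point set" and w :: "point \<Rightarrow> real"
  assumes "valid_game G C1 C2"
    and "\<kappa> > 0"
    and "\<And>j p. p \<in> closed_dom G \<Longrightarrow> Z j p \<in> impulses G"
    and "Ibar \<subseteq> closed_dom G"
    and "viscosity_supersolution G Z \<kappa> i Ibar 0 0 w"
    and "\<rho> > max (2 * drift G + (vol G)\<^sup>2 - disc G i) 0"
    and "A > cap G i / (disc G i + \<rho>)"
    and "B > cap G i / (disc G i + \<rho> - 2 * drift G - (vol G)\<^sup>2)"
    and "C1 / (lam G * zmax G) * exp (- \<rho> * horizon G) > C" and "C > 0"
    and "\<kappa> / (lam G * zmax G) * exp (- \<rho> * horizon G) > D" and "D > 0"
  shows "\<exists>\<eta> \<eta>'. \<eta> > 0 \<and> \<eta>' > 0 \<and>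
    (\<forall>\<gamma>\<in>{0<..<1}. viscosity_supersolution G Z \<kappa> i Ibar (\<gamma> * \<eta>') (\<gamma> * \<eta>)
       (\<lambda>p. (1 - \<gamma>) * w p + \<gamma> * strict_barrier G i \<rho> A B C D p))"
proof -
  define h where "h = strict_barrier G i \<rho> A B C D"
  let ?D = "closed_dom G"
  have pos: "0 < lam G" "0 < zmax G" "0 < cap G i" "0 \<le> disc G i" "0 < \<rho>"
    and cost: "\<And>y \<zeta>. 0 \<le> y \<Longrightarrow> \<zeta> \<in> impulses G \<Longrightarrow> C1 \<le> cost G i y \<zeta>"
    using assms(1,6) by (auto simp: valid_game_def)
  have A: "cap G i < (disc G i + \<rho>) * A"
    using assms(7) pos by (simp add: field_simps)
  have B: "cap G i < (disc G i + \<rho> - 2 * drift G - (vol G)\<^sup>2) * B"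
    using assms(6,8) by (simp add: pos_divide_less_eq mult.commute)
  define \<eta>1 where "\<eta>1 = (disc G i + \<rho>) * A - cap G i"
  define \<eta>2 where "\<eta>2 = C1 - C * (lam G * zmax G) * exp (\<rho> * horizon G)"
  define \<eta>' where "\<eta>' = \<kappa> - D * (lam G * zmax G) * exp (\<rho> * horizon G)"
  define \<eta> where "\<eta> = min \<eta>1 \<eta>2"
  have \<eta>s: "0 < \<eta>1" "0 < \<eta>2" "0 < \<eta>'"
    using A impulse_gain_less[OF assms(9)] impulse_gain_less[OF assms(11)] pos
    by (auto simp: \<eta>1_def \<eta>2_def \<eta>'_def)

  have own: "h (t, x, set_price y i (\<Gamma> G (y $ i) \<zeta>)) - cost G i (y $ i) \<zeta> + \<eta>2 \<le> h (t, x, y)"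
    if "(t, x, y) \<in> ?D" "\<zeta> \<in> impulses G" for t x y \<zeta>
  proof -
    have y: "0 \<le> y $ k" for k
      using closed_dom_price_nonneg that by blast
    then have "h (t, x, set_price y i (\<Gamma> G (y $ i) \<zeta>))
        \<le> h (t, x, y) + C * (lam G * zmax G) * exp (\<rho> * horizon G)"
      unfolding h_def using that pos assms(10)
      by (intro strict_barrier_own_impulse) (auto simp: closed_dom_def impulses_def)
    then show ?thesis
      using cost[OF y[of i] that(2)] by (simp add: \<eta>2_def)
  qed
  have riv: "\<H> G Z \<kappa> i h p + \<eta>' \<le> h p" if p: "p \<in> ?D" for p
  proof -
    obtain t x y where p': "p = (t, x, y)" by (cases p)
    have "Z (rival i) p \<le> zmax G"
      using assms(3)[OF p] by (auto simp: impulses_def)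
    moreover have "0 \<le> y $ k" for k
      using closed_dom_price_nonneg p p' by blast
    moreover have "0 \<le> t"
      using p p' by (auto simp: closed_dom_def)
    ultimately show ?thesis
      using strict_barrier_rival_impulse[of t y \<rho> D G "Z (rival i) p" i A B C x] pos assms(12)
      by (simp add: \<H>_def \<eta>'_def h_def p')
  qed
  have both: "\<H> G Z \<kappa> i h (t, x, set_price y i (\<Gamma> G (y $ i) \<zeta>)) - cost G i (y $ i) \<zeta> + \<eta>' \<le> h (t, x, y)"
    if "(t, x, y) \<in> ?D" "\<zeta> \<in> impulses G" for t x y \<zeta>
  proof -
    have "(t, x, set_price y i (\<Gamma> G (y $ i) \<zeta>)) \<in> ?D"
      using that(1) by (auto simp: closed_dom_def closed_states_def set_price_nth \<Gamma>_def)
    from riv[OF this] own[OF that] show ?thesis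
      using \<eta>s by simp
  qed

  have "viscosity_supersolution G Z \<kappa> i Ibar (\<gamma> * \<eta>') (\<gamma> * \<eta>) (\<lambda>p. (1 - \<gamma>) * w p + \<gamma> * h p)"
    if \<gamma>: "0 < \<gamma>" "\<gamma> < 1" for \<gamma>
    unfolding viscosity_supersolution_def
  proof (intro conjI ballI allI impI)
    let ?u = "\<lambda>p. (1 - \<gamma>) * w p + \<gamma> * h p"
    have "continuous_on (open_dom G) h"
      unfolding h_def by (rule continuous_on_subset[OF continuous_on_barrier(1) open_dom_subset_closed_dom])
    then show "lower_semicontinuous_on (open_dom G) ?u"
      using assms(5) \<gamma>
      by (intro lower_semicontinuous_on_add_continuous continuous_intros)
         (auto simp: viscosity_supersolution_def)
    fix p \<phi>
    assume p: "p \<in> open_dom G"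
      and "C12 ?D \<phi> \<and> ?u p - \<phi> p = 0 \<and> (\<forall>q\<in>open_dom G. ?u p - \<phi> p \<le> ?u q - \<phi> q)"
    then have \<phi>: "C12 ?D \<phi>" "\<phi> p = ?u p" and touch: "\<And>q. q \<in> open_dom G \<Longrightarrow> \<phi> q \<le> ?u q"
      by auto
    have pD: "p \<in> ?D"
      using p open_dom_subset_closed_dom by blast
    obtain t x y where p': "p = (t, x, y)" by (cases p)
    have h: "C12 ?D h"
      unfolding h_def by (rule C12_strict_barrier)

    define \<psi> where "\<psi> = (\<lambda>q. 1 / (1 - \<gamma>) * \<phi> q + (- \<gamma> / (1 - \<gamma>)) * h q)"
    have \<psi>: "C12 ?D \<psi>"
      unfolding \<psi>_def by (rule C12_lincomb[OF \<phi>(1) h])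
    have \<psi>p: "\<psi> p = w p"
      using \<gamma> \<phi>(2) by (simp add: \<psi>_def divide_simps)
    have \<psi>le: "\<psi> q \<le> w q" if "q \<in> open_dom G" for q
    proof -
      have "\<psi> q = (\<phi> q - \<gamma> * h q) / (1 - \<gamma>)"
        by (simp add: \<psi>_def diff_divide_distrib)
      also have "\<dots> \<le> w q"
        using touch[OF that] \<gamma> by (simp add: pos_divide_le_eq mult.commute)
      finally show ?thesis .
    qed
    have w: "p \<in> Ibar \<Longrightarrow> ereal 0 \<le> ereal (w p) - \<M> G i (\<H> G Z \<kappa> i w) p"
        "p \<in> Ibar \<Longrightarrow> \<H> G Z \<kappa> i w p \<le> w p"
        "p \<in> ?D - Ibar \<Longrightarrow> 0 \<le> generator G i \<psi> p - payoff G i (snd p)"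
        "p \<in> ?D - Ibar \<Longrightarrow> ereal 0 \<le> ereal (w p) - \<M> G i w p"
      using assms(5)[unfolded viscosity_supersolution_def, THEN conjunct2, rule_format, OF p, of \<psi>]
        \<psi> \<psi>p \<psi>le
      by (auto simp: generator_def min.bounded_iff)

    show "ereal (\<gamma> * \<eta>') \<le> min (ereal (?u p) - \<M> G i (\<H> G Z \<kappa> i ?u) p) (ereal (?u p - \<H> G Z \<kappa> i ?u p))"
      if "p \<in> Ibar"
    proof (rule min.boundedI)
      show "ereal (\<gamma> * \<eta>') \<le> ereal (?u p) - \<M> G i (\<H> G Z \<kappa> i ?u) p"
        unfolding \<H>_convex_combination p'
        by (rule intervention_convex_combination)
           (use w(1)[OF that] both pD \<gamma> p' in auto)
      have "\<gamma> * (\<H> G Z \<kappa> i h p + \<eta>') \<le> \<gamma> * h p"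
        using riv[OF pD] \<gamma> by (intro mult_left_mono) auto
      moreover have "(1 - \<gamma>) * \<H> G Z \<kappa> i w p \<le> (1 - \<gamma>) * w p"
        using w(2)[OF that] \<gamma> by (intro mult_left_mono) auto
      ultimately show "ereal (\<gamma> * \<eta>') \<le> ereal (?u p - \<H> G Z \<kappa> i ?u p)"
        unfolding \<H>_convex_combination by (simp add: algebra_simps)
    qed

    show "ereal (\<gamma> * \<eta>) \<le> min (ereal (- partial ?D time_dir \<phi> p - \<L> G \<phi> p + disc G i * \<phi> p
              - payoff G i (snd p))) (ereal (?u p) - \<M> G i ?u p)"
      if that: "p \<in> ?D - Ibar"
    proof (rule min.boundedI)
      have "\<gamma> * (\<eta>1 + payoff G i (snd p)) \<le> \<gamma> * generator G i h p"
        using strict_barrier_generator[of G i \<rho> A B C D p] A B pos assms(10,12) pD \<gamma>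
        by (intro mult_left_mono) (auto simp: h_def \<eta>1_def)
      moreover have "(1 - \<gamma>) * payoff G i (snd p) \<le> (1 - \<gamma>) * generator G i \<psi> p"
        using w(3)[OF that] \<gamma> by (intro mult_left_mono) auto
      moreover have "(1 - \<gamma>) * generator G i \<psi> p = generator G i \<phi> p - \<gamma> * generator G i h p"
        unfolding \<psi>_def generator_lincomb[OF \<phi>(1) h pD]
        using \<gamma>(2) by (simp add: right_diff_distrib less_imp_neq)
      moreover have "\<gamma> * \<eta> \<le> \<gamma> * \<eta>1"
        using \<gamma> by (intro mult_left_mono) (auto simp: \<eta>_def)
      ultimately have "\<gamma> * \<eta> \<le> generator G i \<phi> p - payoff G i (snd p)"
        by (simp add: algebra_simps)
      then show "ereal (\<gamma> * \<eta>) \<le> ereal (- partial ?D time_dir \<phi> p - \<L> G \<phi> p + disc G i * \<phi> p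
          - payoff G i (snd p))"
        by (simp add: generator_def)
      have "h (t, x, set_price y i (\<Gamma> G (y $ i) \<zeta>)) - cost G i (y $ i) \<zeta> + \<eta> \<le> h p"
        if "\<zeta> \<in> impulses G" for \<zeta>
        using own[OF pD[unfolded p'] that] p' by (simp add: \<eta>_def)
      then show "ereal (\<gamma> * \<eta>) \<le> ereal (?u p) - \<M> G i ?u p"
        unfolding p' by (intro intervention_convex_combination) (use w(4)[OF that] \<gamma> p' in auto)
    qed
  qed
  then show ?thesis
    using \<eta>s unfolding h_def \<eta>_def
    by (intro exI[of _ "min \<eta>1 \<eta>2"] exI[of _ \<eta>']) auto
qed

end
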